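(* Let $\mathfrak g$ and $\mathfrak h$ be two Leibniz algebras. Then the equivalence relation on $Z^2(\mathfrak g,\mathfrak h)$ coincides with the equivalence relation on $MC(L)$, under the identification of $(l,r,\omega)\in Z^2(\mathfrak g,\mathfrak h)$ with $l+r+\omega\in MC(L)$; that is, two cocycles $(l,r,\omega),(l',r',\omega')\in Z^2(\mathfrak g,\mathfrak h)$ are equivalent if and only if the Maurer–Cartan elements $l+r+\omega$ and $l'+r'+\omega'$ are equivalent.
   Context: All vector spaces are over a fixed ground field of characteristic different from 2. A (left) Leibniz algebra is a vector space with a bilinear bracket satisfying $[x,[y,z]]=[[x,y],z]+[y,[x,z]]$. $\mathrm{ad}^L_x(y)=[x,y]$, $\mathrm{ad}^R_x(y)=[y,x]$; $[D_1,D_2]=D_1D_2-D_2D_1$ for linear endomorphisms. Cocycles: $\mathrm{Der}^L(\mathfrak h)=\{D\in\mathfrak{gl}(\mathfrak h): D[\alpha,\beta]_{\mathfrak h}=[D\alpha,\beta]_{\mathfrak h}+[\alpha,D\beta]_{\mathfrak h}\}$, $\mathrm{Der}^R(\mathfrak h)=\{D\in\mathfrak{gl}(\mathfrak h): D[\alpha,\beta]_{\mathfrak h}=[\alpha,D\beta]_{\mathfrak h}-[\beta,D\alpha]_{\mathfrak h}\}$. $Z^2(\mathfrak g,\mathfrak h)$ is the set of triples $(l,r,\omega)$ of linear maps $l:\mathfrak g\to\mathrm{Der}^L(\mathfrak h)$, $r:\mathfrak g\to\mathrm{Der}^R(\mathfrak h)$, $\omega:\mathfrak g\otimes\mathfrak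 g\to\mathfrak h$ such that for all $x,y,z\in\mathfrak g$, $\alpha,\beta\in\mathfrak h$: $[l_x\alpha+r_x\alpha,\beta]_{\mathfrak h}=0$; $[l_x,l_y]-l_{[x,y]_{\mathfrak g}}=\mathrm{ad}^L_{\omega(x,y)}$; $[l_x,r_y]-r_{[x,y]_{\mathfrak g}}=\mathrm{ad}^R_{\omega(x,y)}$; $r_y(r_x(\alpha)+l_x(\alpha))=0$; $l_x\omega(y,z)-l_y\omega(x,z)-r_z\omega(x,y)=\omega([x,y]_{\mathfrak g},z)-\omega(x,[y,z]_{\mathfrak g})+\omega(y,[x,z]_{\mathfrak g})$. Two cocycles $(l^1,r^1,\omega^1)$ and $(l^2,r^2,\omega^2)$ are equivalent if there is a linear $\varphi:\mathfrak g\to\mathfrak h$ with $l^1_x-l^2_x=\mathrm{ad}^L_{\varphi(x)}$, $r^1_x-r^2_x=\mathrm{ad}^R_{\varphi(x)}$, $\omega^1(x,y)-\omega^2(x,y)=l^2_x\varphi(y)+r^2_y\varphi(x)+[\varphi(x),\varphi(y)]_{\mathfrak h}-\varphi([x,y]_{\mathfrak g})$ for all $x,y\in\mathfrak g$. The DGLA $L$: for a vector space $E$ put $C^k(E,E)=\mathrm{Hom}(\otimes^{k+1}E,E)$, $k\ge0$. For $P\in C^p(E,E)$, $Q\in C^q(E,E)$, $P\circ Q\in C^{p+q}(E,E)$ is $$P\circ Q(x_1,\dots,x_{p+q+1})=\sum_{k=0}^p(-1)^{kq}\sum_{\sigma\in sh(k,q)}\mathrm{sgn}(\sigma)P(x_{\sigma(1)},\dots,x_{\sigma(k)},Q(x_{\sigma(k+1)},\dots,x_{\sigma(k+q)},x_{k+q+1}),x_{k+q+2},\dots,x_{p+q+1}),$$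 where $sh(k,q)$ is the set of $(k,q)$-shuffles, and $[P,Q]_C=P\circ Q+(-1)^{pq+1}Q\circ P$. Let $E=\mathfrak g\oplus\mathfrak h$ be the direct sum Leibniz algebra, with bracket $\mu(x+\alpha,y+\beta)=[x,y]_{\mathfrak g}+[\alpha,\beta]_{\mathfrak h}$, and $\overline\partial P=[\mu,P]_C$. Then $(C(E,E),[\cdot,\cdot]_C,\overline\partial)$ is a DGLA. Let $L_k=C^k_>(\mathfrak g\oplus\mathfrak h,\mathfrak h)$ be the space of those $P\in\mathrm{Hom}(\otimes^{k+1}(\mathfrak g\oplus\mathfrak h),\mathfrak h)$ vanishing on $\otimes^{k+1}\mathfrak h$ (so $\mathrm{Hom}(\otimes^{k+1}(\mathfrak g\oplus\mathfrak h),\mathfrak h)=L_k\oplus\mathrm{Hom}(\otimes^{k+1}\mathfrak h,\mathfrak h)$). $L=\oplus_kL_k$ is a sub-DGLA, with $L_0=\mathrm{Hom}(\mathfrak g,\mathfrak h)$ and $L_1=\mathrm{Hom}(\otimes^2\mathfrak g,\mathfrak h)\oplus\mathrm{Hom}(\mathfrak g\otimes\mathfrak h,\mathfrak h)\oplus\mathrm{Hom}(\mathfrak h\otimes\mathfrak g,\mathfrak h)$. $MC(L)=\{c\in L_1:\overline\partial c+\tfrac12[c,c]_C=0\}$. Linear maps $l,r:\mathfrak g\to\mathfrak{gl}(\mathfrak h)$ are viewed as elements of $\mathrm{Hom}(\mathfrak g\otimes\mathfrak h,\mathfrak h)$ and $\mathrm{Hom}(\mathfrak h\otimes\mathfrak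 g,\mathfrak h)$ via $l(x,\alpha)=l_x(\alpha)$, $r(\alpha,x)=r_x(\alpha)$; under this, $(l,r,\omega)\mapsto l+r+\omega$ is a bijection $Z^2(\mathfrak g,\mathfrak h)\to MC(L)$. Two elements $c,c'\in L_1$ are equivalent if there is $\varphi\in L_0$ with $c'=c+[c,\varphi]_C+\overline\partial\varphi+\tfrac12[\overline\partial\varphi,\varphi]_C$. *)

theory Defs
  imports "HOL-Combinatorics.Permutations" "HOL-Analysis.Product_Vector"
    "HOL-Computational_Algebra.Computational_Algebra"
begin

section \<open>Left Leibniz algebras\<close>

definition bilinear_map ::
  "('k::field \<Rightarrow> 'a::ab_group_add \<Rightarrow> 'a) \<Rightarrow> ('k \<Rightarrow> 'b::ab_group_add \<Rightarrow> 'b) \<Rightarrow>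
   ('k \<Rightarrow> 'c::ab_group_add \<Rightarrow> 'c) \<Rightarrow> ('a \<Rightarrow> 'b \<Rightarrow> 'c) \<Rightarrow> bool" where
  "bilinear_map s1 s2 s3 f \<longleftrightarrow>
     (\<forall>x. Vector_Spaces.linear s2 s3 (\<lambda>y. f x y)) \<and>
     (\<forall>y. Vector_Spaces.linear s1 s3 (\<lambda>x. f x y))"

locale leibniz_algebra = vector_space scale
  for scale :: "'k::field \<Rightarrow> 'a::ab_group_add \<Rightarrow> 'a" +
  fixes bracket :: "'a \<Rightarrow> 'a \<Rightarrow> 'a"
  assumes bilinear: "bilinear_map scale scale scale bracket"
    and leibniz: "bracket x (bracket y z) = bracket (bracket x y) z + bracket y (bracket x z)"


section \<open>Non-abelian cocycles\<close>

definition DerL :: "('k::field \<Rightarrow> 'h::ab_group_add \<Rightarrow> 'h) \<Rightarrow> ('h \<Rightarrow> 'h \<Rightarrow> 'h) \<Rightarrow> ('h \<Rightarrow> 'h) set" where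
  "DerL sh bh = {D. Vector_Spaces.linear sh sh D \<and>
     (\<forall>\<alpha> \<beta>. D (bh \<alpha> \<beta>) = bh (D \<alpha>) \<beta> + bh \<alpha> (D \<beta>))}"

definition DerR :: "('k::field \<Rightarrow> 'h::ab_group_add \<Rightarrow> 'h) \<Rightarrow> ('h \<Rightarrow> 'h \<Rightarrow> 'h) \<Rightarrow> ('h \<Rightarrow> 'h) set" where
  "DerR sh bh = {D. Vector_Spaces.linear sh sh D \<and>
     (\<forall>\<alpha> \<beta>. D (bh \<alpha> \<beta>) = bh \<alpha> (D \<beta>) - bh \<beta> (D \<alpha>))}"

type_synonym ('g, 'h) cochain = "('g \<Rightarrow> 'h \<Rightarrow> 'h) \<times> ('g \<Rightarrow> 'h \<Rightarrow> 'h) \<times> ('g \<Rightarrow> 'g \<Rightarrow> 'h)"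

text \<open>The equations between endomorphisms of \<open>h\<close> are written pointwise:
  \<open>ad\<^sup>L\<^sub>\<gamma> \<alpha> = bh \<gamma> \<alpha>\<close> and \<open>ad\<^sup>R\<^sub>\<gamma> \<alpha> = bh \<alpha> \<gamma>\<close>.\<close>

definition Z2 ::
  "('k::field \<Rightarrow> 'g::ab_group_add \<Rightarrow> 'g) \<Rightarrow> ('g \<Rightarrow> 'g \<Rightarrow> 'g) \<Rightarrow>
   ('k \<Rightarrow> 'h::ab_group_add \<Rightarrow> 'h) \<Rightarrow> ('h \<Rightarrow> 'h \<Rightarrow> 'h) \<Rightarrow> ('g, 'h) cochain set" where
  "Z2 sg bg sh bh = {(l, r, \<omega>).
     (\<forall>x. l x \<in> DerL sh bh) \<and> (\<forall>\<alpha>. Vector_Spaces.linear sg sh (\<lambda>x. l x \<alpha>)) \<and>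
     (\<forall>x. r x \<in> DerR sh bh) \<and> (\<forall>\<alpha>. Vector_Spaces.linear sg sh (\<lambda>x. r x \<alpha>)) \<and>
     bilinear_map sg sg sh \<omega> \<and>
     (\<forall>x \<alpha> \<beta>. bh (l x \<alpha> + r x \<alpha>) \<beta> = 0) \<and>
     (\<forall>x y \<alpha>. l x (l y \<alpha>) - l y (l x \<alpha>) - l (bg x y) \<alpha> = bh (\<omega> x y) \<alpha>) \<and>
     (\<forall>x y \<alpha>. l x (r y \<alpha>) - r y (l x \<alpha>) - r (bg x y) \<alpha> = bh \<alpha> (\<omega> x y)) \<and>
     (\<forall>x y \<alpha>. r y (r x \<alpha> + l x \<alpha>) = 0) \<and>
     (\<forall>x y z. l x (\<omega> y z) - l y (\<omega> x z) - r z (\<omega> x y) =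
               \<omega> (bg x y) z - \<omega> x (bg y z) + \<omega> y (bg x z))}"

definition Z2_equiv ::
  "('k::field \<Rightarrow> 'g::ab_group_add \<Rightarrow> 'g) \<Rightarrow> ('g \<Rightarrow> 'g \<Rightarrow> 'g) \<Rightarrow>
   ('k \<Rightarrow> 'h::ab_group_add \<Rightarrow> 'h) \<Rightarrow> ('h \<Rightarrow> 'h \<Rightarrow> 'h) \<Rightarrow>
   (('g, 'h) cochain \<times> ('g, 'h) cochain) set" where
  "Z2_equiv sg bg sh bh = {((l1, r1, \<omega>1), (l2, r2, \<omega>2)).
     (l1, r1, \<omega>1) \<in> Z2 sg bg sh bh \<and> (l2, r2, \<omega>2) \<in> Z2 sg bg sh bh \<and>
     (\<exists>\<phi>. Vector_Spaces.linear sg sh \<phi> \<and>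
        (\<forall>x \<alpha>. l1 x \<alpha> - l2 x \<alpha> = bh (\<phi> x) \<alpha>) \<and>
        (\<forall>x \<alpha>. r1 x \<alpha> - r2 x \<alpha> = bh \<alpha> (\<phi> x)) \<and>
        (\<forall>x y. \<omega>1 x y - \<omega>2 x y =
           l2 x (\<phi> y) + r2 y (\<phi> x) + bh (\<phi> x) (\<phi> y) - \<phi> (bg x y)))}"


section \<open>The graded Lie algebra of multilinear maps\<close>

text \<open>An element of \<open>C\<^sup>k(E,E) = Hom(\<otimes>\<^sup>k\<^sup>+\<^sup>1 E, E)\<close> is a multilinear function on lists of length
  \<open>k + 1\<close>; it is extended by \<open>0\<close> to lists of any other length, so that equality in
  \<open>C\<^sup>k(E,E)\<close> is equality of HOL functions.\<close>

definition Ck :: "('k::field \<Rightarrow> 'e::ab_group_add \<Rightarrow> 'e) \<Rightarrow> nat \<Rightarrow> ('e list \<Rightarrow> 'e) set" where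
  "Ck s k = {P. (\<forall>xs. length xs \<noteq> k + 1 \<longrightarrow> P xs = 0) \<and>
     (\<forall>xs i. length xs = k + 1 \<longrightarrow> i < k + 1 \<longrightarrow> Vector_Spaces.linear s s (\<lambda>v. P (xs[i := v])))}"

text \<open>\<open>(k,q)\<close>-shuffles, as permutations of \<open>{0..<k+q}\<close> instead of \<open>{1..k+q}\<close>.\<close>

definition shuffle :: "nat \<Rightarrow> nat \<Rightarrow> (nat \<Rightarrow> nat) set" where
  "shuffle k q = {\<sigma>. \<sigma> permutes {..<k+q} \<and> strict_mono_on {..<k} \<sigma> \<and> strict_mono_on {k..<k+q} \<sigma>}"

text \<open>Arguments are numbered from \<open>0\<close>: the argument \<open>x\<^sub>i\<close> of the usual formula is \<open>xs ! (i - 1)\<close>.\<close>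

definition circ ::
  "('k::field \<Rightarrow> 'e::ab_group_add \<Rightarrow> 'e) \<Rightarrow> nat \<Rightarrow> nat \<Rightarrow> ('e list \<Rightarrow> 'e) \<Rightarrow> ('e list \<Rightarrow> 'e) \<Rightarrow>
   'e list \<Rightarrow> 'e" where
  "circ s p q P Q xs =
     (if length xs = p + q + 1
      then (\<Sum>k=0..p. s ((-1) ^ (k * q))
             (\<Sum>\<sigma>\<in>shuffle k q. s (of_int (sign \<sigma>))
                (P (map (\<lambda>i. xs ! \<sigma> i) [0..<k] @
                    [Q (map (\<lambda>i. xs ! \<sigma> i) [k..<k+q] @ [xs ! (k + q)])] @
                    drop (k + q + 1) xs))))
      else 0)"

definition bracketC ::
  "('k::field \<Rightarrow> 'e::ab_group_add \<Rightarrow> 'e) \<Rightarrow> nat \<Rightarrow> nat \<Rightarrow> ('e list \<Rightarrow> 'e) \<Rightarrow> ('e list \<Rightarrow> 'e) \<Rightarrow>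
   'e list \<Rightarrow> 'e" where
  "bracketC s p q P Q xs = circ s p q P Q xs + s ((-1) ^ (p * q + 1)) (circ s q p Q P xs)"

definition of_binary :: "('e \<Rightarrow> 'e \<Rightarrow> 'e) \<Rightarrow> 'e list \<Rightarrow> 'e::zero" where
  "of_binary b xs = (if length xs = 2 then b (xs ! 0) (xs ! 1) else 0)"


section \<open>The differential graded Lie algebra L\<close>

abbreviation scaleE ::
  "('k \<Rightarrow> 'g \<Rightarrow> 'g) \<Rightarrow> ('k \<Rightarrow> 'h \<Rightarrow> 'h) \<Rightarrow> 'k::field \<Rightarrow> 'g::ab_group_add \<times> 'h::ab_group_add \<Rightarrow> 'g \<times> 'h"
  where "scaleE \<equiv> module_prod.scale"

definition mu :: "('g \<Rightarrow> 'g \<Rightarrow> 'g) \<Rightarrow> ('h \<Rightarrow> 'h \<Rightarrow> 'h) \<Rightarrow>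
    ('g::ab_group_add \<times> 'h::ab_group_add) list \<Rightarrow> 'g \<times> 'h" where
  "mu bg bh = of_binary (\<lambda>(x, \<alpha>) (y, \<beta>). (bg x y, bh \<alpha> \<beta>))"

text \<open>The differential on elements of degree \<open>p\<close>.\<close>

definition dbar ::
  "('k::field \<Rightarrow> 'g::ab_group_add \<Rightarrow> 'g) \<Rightarrow> ('g \<Rightarrow> 'g \<Rightarrow> 'g) \<Rightarrow>
   ('k \<Rightarrow> 'h::ab_group_add \<Rightarrow> 'h) \<Rightarrow> ('h \<Rightarrow> 'h \<Rightarrow> 'h) \<Rightarrow>
   nat \<Rightarrow> (('g \<times> 'h) list \<Rightarrow> 'g \<times> 'h) \<Rightarrow> ('g \<times> 'h) list \<Rightarrow> 'g \<times> 'h" where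
  "dbar sg bg sh bh p P = bracketC (scaleE sg sh) 1 p (mu bg bh) P"

text \<open>Maps with values in \<open>h\<close> are the maps into \<open>E = g \<oplus> h\<close> with vanishing \<open>g\<close>-component, and
  the elements of \<open>h\<close> are those of \<open>E\<close> with vanishing \<open>g\<close>-component.\<close>

definition L ::
  "('k::field \<Rightarrow> 'g::ab_group_add \<Rightarrow> 'g) \<Rightarrow> ('k \<Rightarrow> 'h::ab_group_add \<Rightarrow> 'h) \<Rightarrow>
   nat \<Rightarrow> (('g \<times> 'h) list \<Rightarrow> 'g \<times> 'h) set" where
  "L sg sh k = {P \<in> Ck (scaleE sg sh) k. (\<forall>xs. fst (P xs) = 0) \<and>
     (\<forall>xs. length xs = k + 1 \<longrightarrow> (\<forall>v\<in>set xs. fst v = 0) \<longrightarrow> P xs = 0)}"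

definition MC ::
  "('k::field \<Rightarrow> 'g::ab_group_add \<Rightarrow> 'g) \<Rightarrow> ('g \<Rightarrow> 'g \<Rightarrow> 'g) \<Rightarrow>
   ('k \<Rightarrow> 'h::ab_group_add \<Rightarrow> 'h) \<Rightarrow> ('h \<Rightarrow> 'h \<Rightarrow> 'h) \<Rightarrow>
   (('g \<times> 'h) list \<Rightarrow> 'g \<times> 'h) set" where
  "MC sg bg sh bh = {c \<in> L sg sh 1.
     \<forall>xs. dbar sg bg sh bh 1 c xs +
       scaleE sg sh (1/2) (bracketC (scaleE sg sh) 1 1 c c xs) = 0}"

definition MC_equiv ::
  "('k::field \<Rightarrow> 'g::ab_group_add \<Rightarrow> 'g) \<Rightarrow> ('g \<Rightarrow> 'g \<Rightarrow> 'g) \<Rightarrow>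
   ('k \<Rightarrow> 'h::ab_group_add \<Rightarrow> 'h) \<Rightarrow> ('h \<Rightarrow> 'h \<Rightarrow> 'h) \<Rightarrow>
   ((('g \<times> 'h) list \<Rightarrow> 'g \<times> 'h) \<times> (('g \<times> 'h) list \<Rightarrow> 'g \<times> 'h)) set" where
  "MC_equiv sg bg sh bh = {(c, c').
     c \<in> MC sg bg sh bh \<and> c' \<in> MC sg bg sh bh \<and>
     (\<exists>\<phi> \<in> L sg sh 0. \<forall>xs. c' xs =
        c xs + bracketC (scaleE sg sh) 1 0 c \<phi> xs + dbar sg bg sh bh 0 \<phi> xs +
        scaleE sg sh (1/2)
          (bracketC (scaleE sg sh) 1 0 (dbar sg bg sh bh 0 \<phi>) \<phi> xs))}"

text \<open>The element \<open>l + r + \<omega>\<close> of \<open>L\<^sub>1\<close>.\<close>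

fun cochain_sum ::
  "('g, 'h) cochain \<Rightarrow> ('g::ab_group_add \<times> 'h::ab_group_add) list \<Rightarrow> 'g \<times> 'h" where
  "cochain_sum (l, r, \<omega>) = of_binary (\<lambda>(x, \<alpha>) (y, \<beta>). (0, l x \<beta> + r y \<alpha> + \<omega> x y))"

end

theory Submission
  imports Defs
begin

text \<open>
  In the degrees that matter the shuffle sums collapse. For a binary map \<open>b\<close> and a unary map \<open>f\<close>,
  \<open>[b, f]\<^sub>C(x, y) = b (f x) y + b x (f y) - f (b x y)\<close>, and for binary \<open>a\<close>, \<open>b\<close> the product
  \<open>a \<circ> b\<close> is \<open>a (b x y) z - a x (b y z) + a y (b x z)\<close>, so that \<open>a \<circ> a\<close> measures how far \<open>a\<close> is from
  satisfying the Leibniz identity.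

  An element \<open>\<phi>\<close> of \<open>L\<^sub>0\<close> is a linear map \<open>\<psi> : g \<rightarrow> h\<close>, so it kills its own values. Hence all
  that remains of \<open>[\<partial>\<phi>, \<phi>]\<^sub>C\<close> is \<open>[\<psi> x, \<psi> y] + [\<psi> x, \<psi> y]\<close>, one summand for each argument, and the
  factor \<open>1/2\<close> turns this into the quadratic term \<open>[\<psi> x, \<psi> y]\<close> of the equivalence of cocycles.
  Sorting the result by its parts on \<open>g \<otimes> h\<close>, \<open>h \<otimes> g\<close> and \<open>g \<otimes> g\<close> shows that the gauge
  transformation by \<open>\<phi>\<close> sends \<open>l + r + \<omega>\<close> to the sum of the cochain
  \<open>(l + ad\<^sup>L\<^sub>\<psi>, r + ad\<^sup>R\<^sub>\<psi>, \<omega>(x, y) + l\<^sub>x \<psi>(y) + r\<^sub>y \<psi>(x) + [\<psi>(x), \<psi>(y)] - \<psi>[x, y])\<close>, called \<open>twist \<psi>\<close> of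
  \<open>(l, r, \<omega>)\<close> below (\<open>gauge_action\<close>). As a cochain is determined by its sum, \<open>l + r + \<omega>\<close> and
  \<open>l' + r' + \<omega>'\<close> are equivalent iff \<open>(l', r', \<omega>')\<close> is a twist of \<open>(l, r, \<omega>)\<close>.

  Equivalence of cocycles is the same condition with the two cochains exchanged, since there the
  first cochain is expressed through the second one. The two directions agree because twisting by
  \<open>- \<psi>\<close> inverts twisting by \<open>\<psi>\<close> (\<open>twist_uminus_twist\<close>). What is left is that the sum of a cocycle
  is a Maurer-Cartan element, as \<open>MC_equiv\<close> relates such elements only: by the formula for \<open>\<circ>\<close> this
  says that \<open>\<mu> + l + r + \<omega>\<close> is a Leibniz bracket, which the cocycle conditions express part by part.
\<close>

section \<open>The composition product in low degrees\<close>

definition of_unary :: "('e \<Rightarrow> 'e) \<Rightarrow> 'e list \<Rightarrow> 'e::zero" where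
  "of_unary f xs = (if length xs = 1 then f (xs ! 0) else 0)"

text \<open>A strictly increasing permutation of an initial segment is the identity: if \<open>\<sigma>\<close> fixes all
  numbers below \<open>i\<close>, then the preimage of \<open>i\<close> cannot lie below \<open>i\<close>, and if it lay above, \<open>\<sigma> i\<close> would
  be one of the fixed smaller numbers.\<close>

lemma shuffle_0_right: "shuffle k 0 = {id}"
proof -
  have "\<sigma> = id" if "\<sigma> permutes {..<k}" "strict_mono_on {..<k} \<sigma>" for \<sigma> :: "nat \<Rightarrow> nat"
  proof
    fix i
    have "\<sigma> i = i" if "i < k"
      using that
    proof (induction i rule: less_induct)
      case (less i)
      obtain j where j: "\<sigma> j = i" "j < k"
        using \<open>\<sigma> permutes {..<k}\<close> \<open>i < k\<close> by (metis lessThan_iff permutes_in_image permutes_surj surjD)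
      have "\<not> j < i" using less j by force
      moreover have "\<not> i < j"
      proof
        assume "i < j"
        then have "\<sigma> i < i"
          using that j less.prems \<open>strict_mono_on {..<k} \<sigma>\<close> by (force simp: strict_mono_on_def)
        then have "\<sigma> (\<sigma> i) = \<sigma> i" using less by simp
        then show False
          using \<open>\<sigma> permutes {..<k}\<close> \<open>\<sigma> i < i\<close> by (metis less_irrefl permutes_def)
      qed
      ultimately show ?case using j by (metis linorder_neqE_nat)
    qed
    then show "\<sigma> i = id i"
      using \<open>\<sigma> permutes {..<k}\<close> by (cases "i < k") (auto simp: permutes_def)
  qed
  then show ?thesis
    by (auto simp: shuffle_def strict_mono_on_def)
qed

lemma shuffle_0_left: "shuffle 0 q = {id}"
  using shuffle_0_right[of q] by (simp add: shuffle_def strict_mono_on_def)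

lemma shuffle_1_1: "shuffle 1 1 = {id, transpose 0 1}"
proof -
  have "{..<1 + 1} = {0, 1::nat}" by auto
  moreover have "strict_mono_on {..<1} \<sigma>" "strict_mono_on {1..<1 + 1} \<sigma>" for \<sigma> :: "nat \<Rightarrow> nat"
    by (auto simp: strict_mono_on_def)
  ultimately show ?thesis
    by (simp add: shuffle_def permutes_doubleton_iff insert_Collect) auto
qed

context vector_space
begin

lemma circ_binary_unary:
  "circ scale 1 0 (of_binary b) (of_unary f) = of_binary (\<lambda>x y. b (f x) y + b x (f y))"
proof
  fix xs
  show "circ scale 1 0 (of_binary b) (of_unary f) xs
    = of_binary (\<lambda>x y. b (f x) y + b x (f y)) xs"
  proof (cases "length xs = 2")
    case True
    then obtain x y where "xs = [x, y]"
      by (auto simp: length_Suc_conv numeral_2_eq_2)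
    then show ?thesis
      by (simp add: circ_def of_binary_def of_unary_def shuffle_0_right)
  qed (simp add: circ_def of_binary_def)
qed

lemma circ_unary_binary:
  "circ scale 0 1 (of_unary f) (of_binary b) = of_binary (\<lambda>x y. f (b x y))"
proof
  fix xs
  show "circ scale 0 1 (of_unary f) (of_binary b) xs = of_binary (\<lambda>x y. f (b x y)) xs"
  proof (cases "length xs = 2")
    case True
    then obtain x y where "xs = [x, y]"
      by (auto simp: length_Suc_conv numeral_2_eq_2)
    then show ?thesis
      by (simp add: circ_def of_binary_def of_unary_def shuffle_0_left)
  qed (simp add: circ_def of_binary_def)
qed

lemma circ_binary_binary:
  "circ scale 1 1 (of_binary a) (of_binary b) [x, y, z]
    = a (b x y) z - a x (b y z) + a y (b x z)"
proof -
  have "id \<noteq> transpose 0 (1::nat)"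
    by (metis id_apply transpose_apply_first zero_neq_one)
  then show ?thesis
    by (simp add: circ_def of_binary_def shuffle_0_left shuffle_1_1[simplified] sign_swap_id
        algebra_simps)
qed

lemma bracketC_binary_unary:
  "bracketC scale 1 0 (of_binary b) (of_unary f)
    = of_binary (\<lambda>x y. b (f x) y + b x (f y) - f (b x y))"
  by (rule ext) (simp add: bracketC_def circ_binary_unary[simplified] circ_unary_binary[simplified],
    simp add: of_binary_def)

lemma bracketC_binary_binary:
  "bracketC scale 1 1 (of_binary a) (of_binary b) [x, y, z]
    = (a (b x y) z - a x (b y z) + a y (b x z)) + (b (a x y) z - b x (a y z) + b y (a x z))"
  by (simp add: bracketC_def circ_binary_binary[simplified])

end

section \<open>The differential graded Lie algebra of a pair of Leibniz algebras\<close>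

lemma two_neq_0:
  assumes "CHAR('k::field) \<noteq> 2"
  shows "(2::'k) \<noteq> 0"
proof
  assume "(2::'k) = 0"
  then have "of_nat 2 = (0::'k)" by simp
  then have "CHAR('k) dvd 2" by (simp only: of_nat_eq_0_iff_char_dvd)
  then have "CHAR('k) = 1 \<or> CHAR('k) = 2" using two_is_prime_nat by (metis prime_nat_iff)
  then show False using assms by simp
qed

lemma (in vector_space) scale_half_double:
  assumes "CHAR('a) \<noteq> 2"
  shows "scale (1/2) (v + v) = v"
  using two_neq_0[OF assms] scale_left_distrib[of "1/2" "1/2" v]
  by (simp add: scale_right_distrib)

lemma additive_0_uminus:
  fixes f :: "'u::ab_group_add \<Rightarrow> 'v::ab_group_add"
  assumes "\<And>x y. f (x + y) = f x + f y"
  shows "f 0 = 0" "f (- x) = - f x"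
  using assms[of 0 0] assms[of x "- x"] by (simp_all add: eq_neg_iff_add_eq_0 add.commute)

locale leibniz_algebra_pair = g: leibniz_algebra sg bg + h: leibniz_algebra sh bh
  for sg :: "'k::field \<Rightarrow> 'g::ab_group_add \<Rightarrow> 'g" and bg
    and sh :: "'k \<Rightarrow> 'h::ab_group_add \<Rightarrow> 'h" and bh
begin

sublocale E: vector_space_prod sg sh
  by unfold_locales

lemma bracket_linear:
  "bg (x + x') y = bg x y + bg x' y" "bg x (y + y') = bg x y + bg x y'"
  "bg (sg a x) y = sg a (bg x y)" "bg x (sg a y) = sg a (bg x y)"
  "bh (u + u') v = bh u v + bh u' v" "bh u (v + v') = bh u v + bh u v'"
  "bh (sh a u) v = sh a (bh u v)" "bh u (sh a v) = sh a (bh u v)"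
  using g.bilinear h.bilinear by (simp_all add: bilinear_map_def Vector_Spaces.linear_iff)

lemma bracket_0_uminus:
  "bg 0 y = 0" "bg x 0 = 0" "bh 0 v = 0" "bh u 0 = 0"
  "bh (- u) v = - bh u v" "bh u (- v) = - bh u v"
  using additive_0_uminus[of "\<lambda>x. bg x y"] additive_0_uminus[of "bg x"]
    additive_0_uminus[of "\<lambda>u. bh u v"] additive_0_uminus[of "bh u"] bracket_linear
  by simp_all

text \<open>Elements of \<open>L\<^sub>0\<close> are the linear maps \<open>g \<rightarrow> h\<close>: vanishing on \<open>h\<close> makes \<open>\<phi> (x + \<alpha>)\<close> depend on \<open>x\<close>
  only.\<close>

lemma L_0_iff:
  "\<phi> \<in> L sg sh 0 \<longleftrightarrow>
    (\<exists>\<psi>. Vector_Spaces.linear sg sh \<psi> \<and> \<phi> = of_unary (\<lambda>v. (0, \<psi> (fst v))))"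
proof
  assume L: "\<phi> \<in> L sg sh 0"
  define \<psi> where "\<psi> x = snd (\<phi> [(x, 0)])" for x
  have zero: "\<phi> xs = 0" if "length xs \<noteq> 1" for xs
    using L that by (simp add: L_def Ck_def)
  have fst0: "fst (\<phi> xs) = 0" for xs
    using L by (simp add: L_def)
  have on_h: "\<phi> [(0, \<alpha>)] = 0" for \<alpha>
    using L by (simp add: L_def)
  have "Vector_Spaces.linear E.scale E.scale (\<lambda>v. \<phi> ([0][0 := v]))"
    using L by (simp add: L_def Ck_def del: list_update.simps)
  then have add: "\<phi> [v + w] = \<phi> [v] + \<phi> [w]" and scale: "\<phi> [E.scale a v] = E.scale a (\<phi> [v])"
    for v w a
    by (simp_all add: Vector_Spaces.linear_iff del: split_paired_All)
  have "Vector_Spaces.linear sg sh \<psi>"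
    unfolding Vector_Spaces.linear_iff
  proof (intro conjI allI)
    show "\<psi> (x + y) = \<psi> x + \<psi> y" for x y
      using add[of "(x, 0)" "(y, 0)"] by (simp add: \<psi>_def)
    show "\<psi> (sg a x) = sh a (\<psi> x)" for a x
      using scale[of a "(x, 0)"] by (simp add: \<psi>_def E.scale_prod) (simp add: E.scale_def)
  qed unfold_locales
  moreover have "\<phi> = of_unary (\<lambda>v. (0, \<psi> (fst v)))"
  proof
    fix xs
    show "\<phi> xs = of_unary (\<lambda>v. (0, \<psi> (fst v))) xs"
    proof (cases "length xs = 1")
      case True
      then obtain x \<alpha> where xs: "xs = [(x, \<alpha>)]"
        by (cases xs) auto
      have "\<phi> xs = \<phi> [(x, 0)]"
        using add[of "(x, 0)" "(0, \<alpha>)"] on_h by (simp add: xs)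
      then show ?thesis
        using fst0 by (simp add: xs of_unary_def \<psi>_def prod_eq_iff)
    qed (simp add: zero of_unary_def)
  qed
  ultimately show "\<exists>\<psi>. Vector_Spaces.linear sg sh \<psi> \<and> \<phi> = of_unary (\<lambda>v. (0, \<psi> (fst v)))"
    by blast
next
  assume "\<exists>\<psi>. Vector_Spaces.linear sg sh \<psi> \<and> \<phi> = of_unary (\<lambda>v. (0, \<psi> (fst v)))"
  then obtain \<psi> where lin: "Vector_Spaces.linear sg sh \<psi>"
    and \<phi>: "\<phi> = of_unary (\<lambda>v. (0, \<psi> (fst v)))"
    by blast
  have eqs: "\<psi> (x + y) = \<psi> x + \<psi> y" "\<psi> (sg a x) = sh a (\<psi> x)" for x y a
    using lin by (simp_all add: Vector_Spaces.linear_iff)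
  have "Vector_Spaces.linear E.scale E.scale (\<lambda>v. (0, \<psi> (fst v)))"
    unfolding Vector_Spaces.linear_iff
    by (intro conjI allI E.p.vector_space_axioms) (simp_all add: eqs E.scale_def)
  then show "\<phi> \<in> L sg sh 0"
    using additive_0_uminus(1)[of \<psi>] eqs
    by (auto simp: L_def Ck_def \<phi> of_unary_def length_Suc_conv zero_prod_def)
qed

lemma Z2_linear:
  assumes "(l, r, \<omega>) \<in> Z2 sg bg sh bh"
  shows "l (x + y) \<alpha> = l x \<alpha> + l y \<alpha>" "l x (\<alpha> + \<beta>) = l x \<alpha> + l x \<beta>"
    "l (sg a x) \<alpha> = sh a (l x \<alpha>)" "l x (sh a \<alpha>) = sh a (l x \<alpha>)"
    "r (x + y) \<alpha> = r x \<alpha> + r y \<alpha>" "r x (\<alpha> + \<beta>) = r x \<alpha> + r x \<beta>"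
    "r (sg a x) \<alpha> = sh a (r x \<alpha>)" "r x (sh a \<alpha>) = sh a (r x \<alpha>)"
    "\<omega> (x + y) z = \<omega> x z + \<omega> y z" "\<omega> x (y + z) = \<omega> x y + \<omega> x z"
    "\<omega> (sg a x) y = sh a (\<omega> x y)" "\<omega> x (sg a y) = sh a (\<omega> x y)"
  using assms
  by (simp_all add: Z2_def DerL_def DerR_def bilinear_map_def Vector_Spaces.linear_iff)

lemma Z2_0:
  assumes "(l, r, \<omega>) \<in> Z2 sg bg sh bh"
  shows "l 0 \<alpha> = 0" "l x 0 = 0" "r 0 \<alpha> = 0" "r x 0 = 0" "\<omega> 0 x = 0" "\<omega> x 0 = 0"
  using additive_0_uminus(1)[of "\<lambda>x. l x \<alpha>"] additive_0_uminus(1)[of "l x"]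
    additive_0_uminus(1)[of "\<lambda>x. r x \<alpha>"] additive_0_uminus(1)[of "r x"]
    additive_0_uminus(1)[of "\<lambda>y. \<omega> y x"] additive_0_uminus(1)[of "\<omega> x"] Z2_linear[OF assms]
  by simp_all

lemma Z2_uminus:
  assumes "(l, r, \<omega>) \<in> Z2 sg bg sh bh"
  shows "l x (- \<alpha>) = - l x \<alpha>" "r x (- \<alpha>) = - r x \<alpha>"
  using additive_0_uminus(2)[of "l x"] additive_0_uminus(2)[of "r x"] Z2_linear[OF assms]
  by simp_all

lemma cochain_sum_in_L_1:
  assumes Z: "(l, r, \<omega>) \<in> Z2 sg bg sh bh"
  shows "cochain_sum (l, r, \<omega>) \<in> L sg sh 1"
proof -
  let ?c = "\<lambda>v w. (0, l (fst v) (snd w) + r (fst w) (snd v) + \<omega> (fst v) (fst w))"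
  have c: "cochain_sum (l, r, \<omega>) = of_binary ?c"
    by (simp add: case_prod_beta')
  have lin: "Vector_Spaces.linear E.scale E.scale (\<lambda>v. ?c v w)"
    "Vector_Spaces.linear E.scale E.scale (\<lambda>v. ?c w v)" for w
    unfolding Vector_Spaces.linear_iff
    by (auto intro!: E.p.vector_space_axioms
        simp: Z2_linear[OF Z] E.scale_def algebra_simps)
  have "Vector_Spaces.linear E.scale E.scale (\<lambda>v. of_binary ?c (xs[i := v]))"
    if "length xs = 2" "i < 2" for xs i
  proof -
    obtain x y where xs: "xs = [x, y]"
      using \<open>length xs = 2\<close> by (auto simp: length_Suc_conv numeral_2_eq_2)
    consider "i = 0" | "i = 1" using \<open>i < 2\<close> by linarith
    then show ?thesis
      by cases (use lin in \<open>simp_all add: xs of_binary_def\<close>)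
  qed
  then show ?thesis
    unfolding c by (auto simp: L_def Ck_def of_binary_def Z2_0[OF Z] zero_prod_def)
qed

text \<open>As \<open>(1/2) [c, c] = c \<circ> c\<close> and \<open>\<mu> \<circ> \<mu> = 0\<close>, the Maurer-Cartan equation is the Leibniz identity
  \<open>(\<mu> + c) \<circ> (\<mu> + c) = 0\<close>. On \<open>h \<otimes> h \<otimes> h\<close> it is trivial, because \<open>c\<close> vanishes on \<open>h \<otimes> h\<close>; on
  each other product of copies of \<open>g\<close> and \<open>h\<close> it is a combination of cocycle conditions.\<close>

lemma cochain_sum_in_MC:
  assumes char: "CHAR('k) \<noteq> 2" and Z: "(l, r, \<omega>) \<in> Z2 sg bg sh bh"
  shows "cochain_sum (l, r, \<omega>) \<in> MC sg bg sh bh"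
proof -
  let ?c = "cochain_sum (l, r, \<omega>)"
  have "dbar sg bg sh bh 1 ?c xs + E.scale (1/2) (bracketC E.scale 1 1 ?c ?c xs) = 0" for xs
  proof (cases "length xs = 3")
    case True
    then obtain X Y W where "xs = [X, Y, W]"
      by (auto simp: length_Suc_conv numeral_3_eq_3)
    then obtain x \<alpha> y \<beta> z \<gamma> where xs: "xs = [(x, \<alpha>), (y, \<beta>), (z, \<gamma>)]"
      by (cases X, cases Y, cases W) blast
    \<comment> \<open>The cocycle conditions at the arguments where they occur in the expansion. They come in two
      groups: derivation rules, which remove \<open>l\<close> and \<open>r\<close> in front of a bracket of \<open>h\<close>, and relations
      which can be solved for one term each.\<close>
    have eqs:
      "l x (bh \<beta> \<gamma>) = bh (l x \<beta>) \<gamma> + bh \<beta> (l x \<gamma>)"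
      "l y (bh \<alpha> \<gamma>) = bh (l y \<alpha>) \<gamma> + bh \<alpha> (l y \<gamma>)"
      "r z (bh \<alpha> \<beta>) = bh \<alpha> (r z \<beta>) - bh \<beta> (r z \<alpha>)"
      "bh (l x \<beta>) \<gamma> + bh (r x \<beta>) \<gamma> = 0"
      "bh (l y \<alpha>) \<gamma> + bh (r y \<alpha>) \<gamma> = 0"
      "l x (l y \<gamma>) - l y (l x \<gamma>) - l (bg x y) \<gamma> = bh (\<omega> x y) \<gamma>"
      "l x (r z \<beta>) - r z (l x \<beta>) - r (bg x z) \<beta> = bh \<beta> (\<omega> x z)"
      "l y (r z \<alpha>) - r z (l y \<alpha>) - r (bg y z) \<alpha> = bh \<alpha> (\<omega> y z)"
      "r z (r y \<alpha>) + r z (l y \<alpha>) = 0"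
      "l x (\<omega> y z) - l y (\<omega> x z) - r z (\<omega> x y)
        = \<omega> (bg x y) z - \<omega> x (bg y z) + \<omega> y (bg x z)"
      using Z Z2_linear[OF Z] bracket_linear by (simp_all add: Z2_def DerL_def DerR_def)
    have solved:
      "bh (r x \<beta>) \<gamma> = - bh (l x \<beta>) \<gamma>" "bh (r y \<alpha>) \<gamma> = - bh (l y \<alpha>) \<gamma>"
      "l (bg x y) \<gamma> = l x (l y \<gamma>) - l y (l x \<gamma>) - bh (\<omega> x y) \<gamma>"
      "r (bg x z) \<beta> = l x (r z \<beta>) - r z (l x \<beta>) - bh \<beta> (\<omega> x z)"
      "r (bg y z) \<alpha> = l y (r z \<alpha>) - r z (l y \<alpha>) - bh \<alpha> (\<omega> y z)"
      "r z (r y \<alpha>) = - r z (l y \<alpha>)"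
      "\<omega> (bg x y) z
        = l x (\<omega> y z) - l y (\<omega> x z) - r z (\<omega> x y) + \<omega> x (bg y z) - \<omega> y (bg x z)"
      using eqs(4-10) by (simp_all add: eq_neg_iff_add_eq_0 algebra_simps)
    show ?thesis
      unfolding xs dbar_def mu_def cochain_sum.simps E.p.bracketC_binary_binary
        E.p.scale_half_double[OF char]
      by (simp add: Z2_linear[OF Z] Z2_0[OF Z] bracket_linear bracket_0_uminus zero_prod_def
          eqs(1-3) solved)
  qed (simp add: dbar_def bracketC_def circ_def)
  then show ?thesis
    using cochain_sum_in_L_1[OF Z] by (simp add: MC_def)
qed

section \<open>Gauge transformations as twists of cochains\<close>

definition twist :: "('g \<Rightarrow> 'h) \<Rightarrow> ('g, 'h) cochain \<Rightarrow> ('g, 'h) cochain" where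
  "twist \<psi> = (\<lambda>(l, r, \<omega>).
    (\<lambda>x \<alpha>. l x \<alpha> + bh (\<psi> x) \<alpha>,
     \<lambda>x \<alpha>. r x \<alpha> + bh \<alpha> (\<psi> x),
     \<lambda>x y. \<omega> x y + l x (\<psi> y) + r y (\<psi> x) + bh (\<psi> x) (\<psi> y) - \<psi> (bg x y)))"

text \<open>The second twist sees the already twisted actions. Their correction terms contribute
  \<open>- [\<psi> x, \<psi> y]\<close> twice, which cancels the quadratic terms of the two twists.\<close>

lemma twist_uminus_twist:
  assumes "(l, r, \<omega>) \<in> Z2 sg bg sh bh"
  shows "twist (\<lambda>x. - \<psi> x) (twist \<psi> (l, r, \<omega>)) = (l, r, \<omega>)"
  by (simp add: twist_def fun_eq_iff Z2_uminus[OF assms] bracket_0_uminus)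

text \<open>The values of \<open>c\<close>, \<open>\<phi>\<close> and \<open>\<partial>\<phi>\<close> lie in \<open>h\<close>, where \<open>\<phi>\<close> vanishes. So
  \<open>\<phi>\<close> applied after a bracket survives only in the term \<open>- \<psi> [x, y]\<close> of \<open>\<partial>\<phi>\<close>.\<close>

lemma gauge_action:
  assumes char: "CHAR('k) \<noteq> 2" and Z: "(l, r, \<omega>) \<in> Z2 sg bg sh bh"
    and \<psi>: "Vector_Spaces.linear sg sh \<psi>"
  defines "c \<equiv> cochain_sum (l, r, \<omega>)" and "\<phi> \<equiv> of_unary (\<lambda>v. (0, \<psi> (fst v)))"
  shows "c xs + bracketC E.scale 1 0 c \<phi> xs + dbar sg bg sh bh 0 \<phi> xs +
      E.scale (1/2) (bracketC E.scale 1 0 (dbar sg bg sh bh 0 \<phi>) \<phi> xs)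
    = cochain_sum (twist \<psi> (l, r, \<omega>)) xs"
proof (cases "length xs = 2")
  case True
  then obtain x \<alpha> y \<beta> where xs: "xs = [(x, \<alpha>), (y, \<beta>)]"
    by (auto simp: length_Suc_conv numeral_2_eq_2)
  have \<psi>0: "\<psi> 0 = 0"
    using \<psi> by (intro additive_0_uminus(1)) (simp add: Vector_Spaces.linear_iff)
  have half: "E.scale (1/2) (0, v + v) = (0, v)" for v
    using E.p.scale_half_double[OF char, of "(0, v)"] by simp
  have c_\<phi>: "bracketC E.scale 1 0 c \<phi> xs = (0, l x (\<psi> y) + r y (\<psi> x))"
    unfolding c_def \<phi>_def cochain_sum.simps E.p.bracketC_binary_unary xs
    by (simp add: of_binary_def Z2_0[OF Z] \<psi>0)
  have d: "dbar sg bg sh bh 0 \<phi> = of_binary (\<lambda>(x, \<alpha>) (y, \<beta>).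
      (0, bh (\<psi> x) \<beta> + bh \<alpha> (\<psi> y) - \<psi> (bg x y)))"
    unfolding dbar_def mu_def \<phi>_def E.p.bracketC_binary_unary
    by (rule arg_cong[where f = of_binary]) (auto simp: fun_eq_iff bracket_0_uminus)
  have d_\<phi>: "bracketC E.scale 1 0 (dbar sg bg sh bh 0 \<phi>) \<phi> xs
      = (0, bh (\<psi> x) (\<psi> y) + bh (\<psi> x) (\<psi> y))"
    unfolding d unfolding \<phi>_def E.p.bracketC_binary_unary xs
    by (simp add: of_binary_def \<psi>0 bracket_0_uminus)
  show ?thesis
    unfolding c_\<phi> d_\<phi> half unfolding d c_def xs
    by (simp add: twist_def of_binary_def algebra_simps)
qed (simp add: c_def twist_def dbar_def bracketC_def circ_def of_binary_def)

end

definition zero_preserving :: "('g::ab_group_add, 'h::ab_group_add) cochain \<Rightarrow> bool" where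
  "zero_preserving = (\<lambda>(l, r, \<omega>). \<forall>x \<alpha>. l 0 \<alpha> = 0 \<and> l x 0 = 0 \<and> r 0 \<alpha> = 0 \<and> r x 0 = 0 \<and>
    \<omega> 0 x = 0 \<and> \<omega> x 0 = 0)"

text \<open>The three components are the restrictions of the sum to \<open>g \<otimes> h\<close>, \<open>h \<otimes> g\<close> and \<open>g \<otimes> g\<close>: each
  of these kills two of the three summands.\<close>

lemma inj_on_cochain_sum: "inj_on cochain_sum (Collect zero_preserving)"
proof (rule inj_onI)
  fix c c' :: "('g::ab_group_add, 'h::ab_group_add) cochain"
  assume zero: "c \<in> Collect zero_preserving" "c' \<in> Collect zero_preserving"
    and eq: "cochain_sum c = cochain_sum c'"
  obtain l r \<omega> l' r' \<omega>' where c: "c = (l, r, \<omega>)" "c' = (l', r', \<omega>')"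
    by (metis prod_cases3)
  have "l x \<alpha> = l' x \<alpha>" "r x \<alpha> = r' x \<alpha>" "\<omega> x y = \<omega>' x y" for x y \<alpha>
    using fun_cong[OF eq, of "[(x, 0), (0, \<alpha>)]"] fun_cong[OF eq, of "[(0, \<alpha>), (x, 0)]"]
      fun_cong[OF eq, of "[(x, 0), (y, 0)]"] zero
    by (simp_all add: c zero_preserving_def of_binary_def)
  then show "c = c'"
    by (simp add: c fun_eq_iff)
qed

context leibniz_algebra_pair
begin

lemma zero_preserving_Z2: "c \<in> Z2 sg bg sh bh \<Longrightarrow> zero_preserving c"
  by (cases c) (simp add: zero_preserving_def Z2_0)

lemma zero_preserving_twist:
  "zero_preserving c \<Longrightarrow> \<psi> 0 = 0 \<Longrightarrow> zero_preserving (twist \<psi> c)"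
  by (cases c) (simp add: zero_preserving_def twist_def bracket_0_uminus)

lemma MC_equiv_cochain_sum_iff:
  assumes char: "CHAR('k) \<noteq> 2"
    and Z: "(l, r, \<omega>) \<in> Z2 sg bg sh bh" and Z': "(l', r', \<omega>') \<in> Z2 sg bg sh bh"
  shows "(cochain_sum (l, r, \<omega>), cochain_sum (l', r', \<omega>')) \<in> MC_equiv sg bg sh bh \<longleftrightarrow>
    (\<exists>\<psi>. Vector_Spaces.linear sg sh \<psi> \<and> (l', r', \<omega>') = twist \<psi> (l, r, \<omega>))"
    (is "?equiv \<longleftrightarrow> _")
proof -
  have "?equiv \<longleftrightarrow> (\<exists>\<psi>. Vector_Spaces.linear sg sh \<psi> \<and>
      (\<forall>xs. cochain_sum (l', r', \<omega>') xs = cochain_sum (twist \<psi> (l, r, \<omega>)) xs))"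
    using cochain_sum_in_MC[OF char Z] cochain_sum_in_MC[OF char Z'] gauge_action[OF char Z]
    unfolding MC_equiv_def by (auto simp del: cochain_sum.simps simp: L_0_iff Bex_def)
  also have "\<dots> \<longleftrightarrow>
      (\<exists>\<psi>. Vector_Spaces.linear sg sh \<psi> \<and> (l', r', \<omega>') = twist \<psi> (l, r, \<omega>))"
  proof (intro ex_cong1 conj_cong refl)
    fix \<psi>
    assume "Vector_Spaces.linear sg sh \<psi>"
    then have "\<psi> 0 = 0"
      by (intro additive_0_uminus(1)) (simp add: Vector_Spaces.linear_iff)
    then have "cochain_sum (l', r', \<omega>') = cochain_sum (twist \<psi> (l, r, \<omega>)) \<longleftrightarrow>
        (l', r', \<omega>') = twist \<psi> (l, r, \<omega>)"
      using Z Z' by (intro inj_on_eq_iff[OF inj_on_cochain_sum])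
        (simp_all add: zero_preserving_Z2 zero_preserving_twist)
    then show "(\<forall>xs. cochain_sum (l', r', \<omega>') xs = cochain_sum (twist \<psi> (l, r, \<omega>)) xs) \<longleftrightarrow>
        (l', r', \<omega>') = twist \<psi> (l, r, \<omega>)"
      by (simp only: fun_eq_iff[of "cochain_sum (l', r', \<omega>')"])
  qed
  finally show ?thesis .
qed

lemma linear_uminus:
  "Vector_Spaces.linear sg sh \<psi> \<Longrightarrow> Vector_Spaces.linear sg sh (\<lambda>x. - \<psi> x)"
  by (simp add: Vector_Spaces.linear_iff)

text \<open>The definition expresses the first cocycle as a twist of the second one; the inverse twist turns
  this around.\<close>

lemma Z2_equiv_iff:
  assumes Z: "(l, r, \<omega>) \<in> Z2 sg bg sh bh" and Z': "(l', r', \<omega>') \<in> Z2 sg bg sh bh"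
  shows "((l, r, \<omega>), (l', r', \<omega>')) \<in> Z2_equiv sg bg sh bh \<longleftrightarrow>
    (\<exists>\<psi>. Vector_Spaces.linear sg sh \<psi> \<and> (l', r', \<omega>') = twist \<psi> (l, r, \<omega>))"
proof -
  have "((l, r, \<omega>), (l', r', \<omega>')) \<in> Z2_equiv sg bg sh bh \<longleftrightarrow>
      (\<exists>\<phi>. Vector_Spaces.linear sg sh \<phi> \<and> (l, r, \<omega>) = twist \<phi> (l', r', \<omega>'))"
    using Z Z' by (simp add: Z2_equiv_def twist_def fun_eq_iff algebra_simps)
  also have "\<dots> \<longleftrightarrow>
      (\<exists>\<psi>. Vector_Spaces.linear sg sh \<psi> \<and> (l', r', \<omega>') = twist \<psi> (l, r, \<omega>))"
    using linear_uminus twist_uminus_twist[OF Z] twist_uminus_twist[OF Z'] by metis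
  finally show ?thesis .
qed

end

theorem theorem4p7:
  fixes sg :: "'k::field \<Rightarrow> 'g::ab_group_add \<Rightarrow> 'g"
    and sh :: "'k \<Rightarrow> 'h::ab_group_add \<Rightarrow> 'h"
    and bg :: "'g \<Rightarrow> 'g \<Rightarrow> 'g" and bh :: "'h \<Rightarrow> 'h \<Rightarrow> 'h"
  assumes "CHAR('k) \<noteq> 2"
    and "leibniz_algebra sg bg" and "leibniz_algebra sh bh"
    and "(l, r, \<omega>) \<in> Z2 sg bg sh bh" and "(l', r', \<omega>') \<in> Z2 sg bg sh bh"
  shows "((l, r, \<omega>), (l', r', \<omega>')) \<in> Z2_equiv sg bg sh bh \<longleftrightarrow>
         (cochain_sum (l, r, \<omega>), cochain_sum (l', r', \<omega>')) \<in> MC_equiv sg bg sh bh"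
proof -
  interpret leibniz_algebra_pair sg bg sh bh
    using assms(2,3) by (rule leibniz_algebra_pair.intro)
  show ?thesis
    using Z2_equiv_iff[OF assms(4,5)] MC_equiv_cochain_sum_iff[OF assms(1,4,5)]
    by (rule trans[OF _ sym])
qed

end
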